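(* Let $\overline{C}=\{C,+,-,\times,\div,{}^{*},0,1\}$ be the complex number structure, let $c\neq 0$ be a complex number value in $\overline{C}$, and let $\overline{C}^{c}$ and $\overline{C}_{c}$ be the external and internal representations of the structure scaled by $c$. Then $\overline{C}_{c}$ is algebraically closed if and only if $\overline{C}^{c}$ is algebraically closed if and only if $\overline{C}$ is algebraically closed.
   Context: Elements of $C$ are identified with their values in $\overline{C}$; ${}^{*}$ is complex conjugation. External representation: $\overline{C}^{c}=\{C,+,-,\frac{\times}{c},c\div,c(-)^{*},0,c1\}$, the structure on the same set $C$ with the same $+,-$ as $\overline{C}$, with multiplication $x\,\frac{\times}{c}\,y:=(x\times y)\div c$, division $x\,(c\div)\,y:=c\times(x\div y)$, conjugation $(ca)\mapsto c(a^{*})$, additive identity $0$ and multiplicative identity $c$ (right-hand sides computed in $\overline{C}$). Internal representation: $\overline{C}_{c}=\{C,+_{c},-_{c},\times_{c},\div_{c},{}^{*_{c}},0_{c},1_{c}\}$ is the same structure with values renamed: the element whose value in $\overline{C}$ is $ca$ has value denoted $a_{c}$ in $\overline{C}_{c}$, and the operations and constants are those of $\overline{C}^{c}$ transported along this renaming. Algebraically closed is meant in the usual sense for the field operations of the respective structure (powers and products in a polynomial are formed with the multiplication of that structure). *)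

theory Defs
  imports Complex_Main "HOL-Algebra.Algebraic_Closure"
begin

record 'a complex_structure = "'a ring" +
  minus_op :: "'a \<Rightarrow> 'a \<Rightarrow> 'a"
  div_op :: "'a \<Rightarrow> 'a \<Rightarrow> 'a"
  conj_op :: "'a \<Rightarrow> 'a"

text \<open>Division is total, with \<open>x / 0 = 0\<close>.\<close>

definition Cbar :: "complex complex_structure" where
  "Cbar = \<lparr> carrier = UNIV, monoid.mult = (\<lambda>x y. x * y), one = 1, zero = 0, add = (\<lambda>x y. x + y),
     minus_op = (\<lambda>x y. x - y), div_op = (\<lambda>x y. x / y), conj_op = cnj \<rparr>"

text \<open>The conjugation sends \<open>c * a\<close> to \<open>c * cnj a\<close>; an arbitrary \<open>x\<close> is
  \<open>c * (x / c)\<close> since \<open>c \<noteq> 0\<close> wherever this is used.\<close>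

definition external_rep :: "complex \<Rightarrow> complex complex_structure" where
  "external_rep c = Cbar
     \<lparr> monoid.mult := (\<lambda>x y. (x * y) / c),
       one := c * 1,
       div_op := (\<lambda>x y. c * (x / y)),
       conj_op := (\<lambda>x. c * cnj (x / c)) \<rparr>"

text \<open>\<open>Val c a\<close> is the value written $a_c$: the name, in the structure scaled by \<open>c\<close>, of the
  element whose value in \<open>Cbar\<close> is \<open>c * a\<close>.\<close>

datatype scaled_value = Val complex complex

definition rename_value :: "complex \<Rightarrow> complex \<Rightarrow> scaled_value" where
  "rename_value c x = Val c (x / c)"

definition transport_structure ::
    "('a \<Rightarrow> 'b) \<Rightarrow> 'a complex_structure \<Rightarrow> 'b complex_structure" where
  "transport_structure f S = (let g = inv_into (carrier S) f in
     \<lparr> carrier = f ` carrier S,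
       monoid.mult = (\<lambda>u v. f (g u \<otimes>\<^bsub>S\<^esub> g v)),
       one = f \<one>\<^bsub>S\<^esub>,
       zero = f \<zero>\<^bsub>S\<^esub>,
       add = (\<lambda>u v. f (g u \<oplus>\<^bsub>S\<^esub> g v)),
       minus_op = (\<lambda>u v. f (minus_op S (g u) (g v))),
       div_op = (\<lambda>u v. f (div_op S (g u) (g v))),
       conj_op = (\<lambda>u. f (conj_op S (g u))) \<rparr>)"

definition internal_rep :: "complex \<Rightarrow> scaled_value complex_structure" where
  "internal_rep c = transport_structure (rename_value c) (external_rep c)"

lemma rename_value_mult: "c \<noteq> 0 \<Longrightarrow> rename_value c (c * a) = Val c a"
  by (simp add: rename_value_def)

lemma inv_rename_value:
  assumes "c \<noteq> 0" shows "inv_into UNIV (rename_value c) (Val c a) = c * a"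
proof (rule inv_into_f_eq)
  show "inj (rename_value c)"
    using assms by (auto simp: inj_on_def rename_value_def)
  show "rename_value c (c * a) = Val c a"
    using assms by (rule rename_value_mult)
qed simp

text \<open>In terms of the names, the internal representation looks exactly like \<open>Cbar\<close>.\<close>

lemma internal_rep_simps:
  assumes "c \<noteq> 0"
  shows "carrier (internal_rep c) = range (Val c)"
    and "Val c a \<otimes>\<^bsub>internal_rep c\<^esub> Val c b = Val c (a * b)"
    and "\<one>\<^bsub>internal_rep c\<^esub> = Val c 1"
    and "\<zero>\<^bsub>internal_rep c\<^esub> = Val c 0"
    and "Val c a \<oplus>\<^bsub>internal_rep c\<^esub> Val c b = Val c (a + b)"
    and "minus_op (internal_rep c) (Val c a) (Val c b) = Val c (a - b)"
    and "div_op (internal_rep c) (Val c a) (Val c b) = Val c (a / b)"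
    and "conj_op (internal_rep c) (Val c a) = Val c (cnj a)"
proof -
  have "Val c a \<in> range (rename_value c)" for a
    using rename_value_mult[OF assms] by (metis rangeI)
  then show "carrier (internal_rep c) = range (Val c)"
    by (auto simp: internal_rep_def transport_structure_def external_rep_def Cbar_def Let_def
        rename_value_def)
qed (use assms in \<open>simp_all add: internal_rep_def transport_structure_def external_rep_def Cbar_def
      Let_def inv_rename_value rename_value_def field_simps\<close>)

end

theory Submission
  imports Defs
begin

text \<open>
  Being algebraically closed is a property of the ring structure that is invariant under ring
  isomorphism, and the three structures are isomorphic rings. Scaling \<open>x \<mapsto> c * x\<close> carries
  \<^term>\<open>Cbar\<close> to \<^term>\<open>external_rep c\<close>: the factor \<open>1 / c\<close> in the scaled multiplication
  absorbs exactly the surplus factor in \<open>(c * x) * (c * y)\<close>, and the identity \<open>1\<close> goes to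
  \<open>c\<close>. Renaming carries \<^term>\<open>external_rep c\<close> to \<^term>\<open>internal_rep c\<close>, whose operations are
  transported along it.

  The invariance (\<open>algebraically_closed_iff_of_ring_iso\<close>) comes from moving polynomials and roots
  coefficientwise: given a polynomial over the target, pull its coefficients back, take a root
  there, and push that root forward. Homomorphisms commute with evaluation, and
  every nonconstant polynomial having a root already makes a field algebraically closed.
\<close>

lemma ring_iso_zero:
  assumes "ring R" and "ring S" and "h \<in> ring_iso R S"
  shows "h \<zero>\<^bsub>R\<^esub> = \<zero>\<^bsub>S\<^esub>"
proof -
  interpret ring_hom_ring R S h
    using assms ring_hom_ringI2[of R S h] by (simp add: ring_iso_def)
  show ?thesis by simp
qed

lemma (in algebraically_closed) root_exists:
  assumes p: "p \<in> carrier (poly_ring L)" and deg: "degree p > 0"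
  obtains x where "x \<in> carrier L" and "eval p x = \<zero>"
proof -
  have "size (roots p) > 0"
    using roots_over_carrier[OF p] deg by (simp add: splitted_def)
  then obtain x where "x \<in># roots p"
    by (metis multiset_nonemptyE size_empty less_irrefl)
  then show thesis
    using roots_mem_iff_is_root[OF p] that by (auto simp: is_root_def)
qed

text \<open>
  The inverse isomorphism moves polynomials over \<open>S\<close> to \<open>R\<close>, where they have roots. The
  isomorphism then moves the roots back.
\<close>

lemma algebraically_closed_of_ring_iso:
  assumes R: "algebraically_closed R" and S: "ring S" and h: "h \<in> ring_iso R S"
  shows "algebraically_closed S"
proof -
  interpret R: algebraically_closed R by fact
  have "field (S \<lparr> zero := h \<zero>\<^bsub>R\<^esub> \<rparr>)"
    by (rule R.ring_iso_imp_img_field[OF h])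
  then interpret S: field S
    by (simp add: ring_iso_zero[OF R.ring_axioms S h])
  define g where "g = inv_into (carrier R) h"
  have g: "g \<in> ring_iso S R"
    unfolding g_def by (rule ring_iso_set_sym[OF R.ring_axioms h])
  interpret h: ring_hom_ring R S h
    using R.ring_axioms S h ring_hom_ringI2[of R S h] by (simp add: ring_iso_def)
  have hg: "h (g y) = y" if "y \<in> carrier S" for y
    unfolding g_def using ring_iso_memE(5)[OF h] that by (rule bij_betw_inv_into_right)
  show ?thesis
  proof (rule S.algebraically_closedI)
    fix p assume p: "p \<in> carrier (poly_ring S)" and deg: "degree p > 1"
    have gp: "map g p \<in> carrier (poly_ring R)"
      using g by (intro polynomial_hom[OF _ S.field_axioms R.field_axioms p])
        (simp add: ring_iso_def)
    obtain x where x: "x \<in> carrier R" "R.eval (map g p) x = \<zero>\<^bsub>R\<^esub>"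
      using deg by (auto intro: R.root_exists[OF gp])
    have sets: "set p \<subseteq> carrier S" "set (map g p) \<subseteq> carrier R"
      using p gp by (auto simp: univ_poly_carrier[symmetric] polynomial_def)
    have "map h (map g p) = p"
      using sets(1) hg by (auto intro!: map_idI)
    then have "S.eval p (h x) = h (R.eval (map g p) x)"
      using h.eval_hom'[OF x(1) sets(2)] by simp
    then show "\<exists>y\<in>carrier S. S.eval p y = \<zero>\<^bsub>S\<^esub>"
      using x by auto
  qed
qed

lemma algebraically_closed_iff_of_ring_iso:
  assumes "ring R" and "ring S" and "h \<in> ring_iso R S"
  shows "algebraically_closed R \<longleftrightarrow> algebraically_closed S"
  using assms algebraically_closed_of_ring_iso ring_iso_set_sym by metis

lemma ring_Cbar: "ring Cbar"
proof (rule ringI)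
  show "abelian_group Cbar"
    by (rule abelian_groupI) (auto simp: Cbar_def intro: exI[of _ "- _"])
  show "monoid Cbar"
    by unfold_locales (auto simp: Cbar_def)
qed (auto simp: Cbar_def algebra_simps)

lemma scaling_ring_iso:
  assumes "c \<noteq> 0"
  shows "(\<lambda>x. c * x) \<in> ring_iso Cbar (external_rep c)"
proof (rule ring_iso_memI)
  have "bij (\<lambda>x. c * x)"
    by (rule bij_betw_byWitness[where f' = "\<lambda>x. x / c"]) (use assms in auto)
  then show "bij_betw (\<lambda>x. c * x) (carrier Cbar) (carrier (external_rep c))"
    by (simp add: Cbar_def external_rep_def)
qed (use assms in \<open>auto simp: Cbar_def external_rep_def field_simps\<close>)

text \<open>
  The ring axioms are inherited from \<^term>\<open>Cbar\<close> along the scaling map. The set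
  \<^const>\<open>ring_iso\<close> says nothing about the zero, so an isomorphic image is known to be
  a ring only once its zero is the image of the old one. Here it is, as \<open>c * 0 = 0\<close>.
\<close>

lemma ring_external_rep:
  assumes "c \<noteq> 0"
  shows "ring (external_rep c)"
proof -
  have "external_rep c \<lparr> zero := c * \<zero>\<^bsub>Cbar\<^esub> \<rparr> = external_rep c"
    by (simp add: external_rep_def Cbar_def)
  then show ?thesis
    using ring.ring_iso_imp_img_ring[OF ring_Cbar scaling_ring_iso[OF assms]] by simp
qed

lemma rename_value_ring_iso:
  assumes "c \<noteq> 0"
  shows "rename_value c \<in> ring_iso (external_rep c) (internal_rep c)"
proof (rule ring_iso_memI)
  have "inj (rename_value c)"
    using assms by (auto simp: inj_on_def rename_value_def)
  then show "bij_betw (rename_value c) (carrier (external_rep c)) (carrier (internal_rep c))"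
    by (simp add: bij_betw_def internal_rep_def transport_structure_def Let_def
        external_rep_def Cbar_def)
qed (use assms in \<open>auto simp: internal_rep_simps rename_value_def external_rep_def Cbar_def
      field_simps\<close>)

lemma ring_internal_rep:
  assumes "c \<noteq> 0"
  shows "ring (internal_rep c)"
proof -
  have "internal_rep c \<lparr> zero := rename_value c \<zero>\<^bsub>external_rep c\<^esub> \<rparr> = internal_rep c"
    by (simp add: internal_rep_def transport_structure_def Let_def)
  then show ?thesis
    using ring.ring_iso_imp_img_ring[OF ring_external_rep rename_value_ring_iso, OF assms assms]
    by simp
qed

theorem theorem8:
  fixes c :: complex
  assumes "c \<noteq> 0"
  shows "(algebraically_closed (internal_rep c) \<longleftrightarrow> algebraically_closed (external_rep c)) \<and>
         (algebraically_closed (external_rep c) \<longleftrightarrow> algebraically_closed Cbar)"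
  using algebraically_closed_iff_of_ring_iso[OF ring_external_rep ring_internal_rep
      rename_value_ring_iso, OF assms assms assms]
    algebraically_closed_iff_of_ring_iso[OF ring_Cbar ring_external_rep scaling_ring_iso,
      OF assms assms]
  by blast

end
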